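(* Let $R$ be a strongly $\Delta$-clean ring. Then $a-a^2\in\Delta(R)$ for every $a\in R$.
   Context: Rings are associative with identity, not necessarily commutative. $U(R)$ is the group of units of $R$. Define $\Delta(R)=\{x\in R \mid 1-xu\in U(R)\text{ for all }u\in U(R)\}$. A ring $R$ is strongly $\Delta$-clean if every $a\in R$ can be written $a=e+d$ with $e^2=e\in R$, $d\in\Delta(R)$ and $ed=de$. *)

theory Defs
  imports "HOL-Algebra.Ring"
begin

definition Delta :: "('a, 'b) ring_scheme \<Rightarrow> 'a set"
  where "Delta R = {x \<in> carrier R. \<forall>u\<in>Units R. \<one>\<^bsub>R\<^esub> \<ominus>\<^bsub>R\<^esub> x \<otimes>\<^bsub>R\<^esub> u \<in> Units R}"

text \<open>The locale \<open>ring\<close> does not assume commutativity of multiplication and admits the zero ring.\<close>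

locale strongly_Delta_clean_ring = ring +
  assumes strongly_Delta_clean:
    "a \<in> carrier R \<Longrightarrow>
      \<exists>e\<in>carrier R. \<exists>d\<in>Delta R. e \<otimes> e = e \<and> e \<otimes> d = d \<otimes> e \<and> a = e \<oplus> d"

end

theory Submission
  imports Defs
begin

text \<open>
  Write \<open>a = e + d\<close>. Then \<open>v = 1 - 2e\<close> satisfies \<open>v\<^sup>2 = 1\<close>, so \<open>v - d = (1 - d v) v\<close> is a
  unit, and \<open>a - a\<^sup>2 = d (v - d)\<close>. Since \<open>\<Delta>(R)\<close> is stable under right multiplication by units,
  the claim follows.
\<close>

text \<open>For a unit \<open>u\<close>, \<open>1 - (d w) u = 1 - d (w u)\<close>, and
  \<open>w u\<close> is again a unit.\<close>

lemma (in ring) Delta_mult_Units: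
  assumes "d \<in> Delta R" "w \<in> Units R"
  shows "d \<otimes> w \<in> Delta R"
  using assms unfolding Delta_def by (simp add: m_assoc Units_closed)

text \<open>Factoring \<open>v\<close> out on the right leaves \<open>1 - d (inv v)\<close>, a unit
  by the definition of \<open>Delta\<close> at \<open>inv v\<close>.\<close>

lemma (in ring) Units_minus_Delta:
  assumes "d \<in> Delta R" "v \<in> Units R"
  shows "v \<ominus> d \<in> Units R"
proof -
  have d: "d \<in> carrier R" and v: "v \<in> carrier R" "inv v \<in> carrier R"
    using assms by (auto simp: Delta_def)
  have "v \<ominus> d = (\<one> \<ominus> d \<otimes> inv v) \<otimes> v"
    using d v assms(2) by (simp add: minus_eq l_distr l_minus m_assoc)
  moreover have "\<one> \<ominus> d \<otimes> inv v \<in> Units R"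
    using assms by (auto simp: Delta_def)
  ultimately show ?thesis
    using assms(2) by simp
qed

text \<open>The square expands to \<open>1 - 4e + 4(e e)\<close>, and idempotence cancels the last
  two terms.\<close>

lemma (in ring) idempotent_involution:
  assumes "e \<in> carrier R" "e \<otimes> e = e"
  shows "(\<one> \<ominus> (e \<oplus> e)) \<otimes> (\<one> \<ominus> (e \<oplus> e)) = \<one>"
  using assms
  by (simp add: minus_eq minus_add l_distr r_distr l_minus r_minus a_ac r_neg r_neg1 r_neg2)

theorem lemma2p10:
  fixes R (structure)
  assumes "strongly_Delta_clean_ring R"
  shows "\<forall>a\<in>carrier R. a \<ominus> a \<otimes> a \<in> Delta R"
proof
  interpret strongly_Delta_clean_ring R by fact
  fix a assume "a \<in> carrier R"
  then obtain e d where e: "e \<in> carrier R" "e \<otimes> e = e" and dD: "d \<in> Delta R"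
    and comm: "e \<otimes> d = d \<otimes> e" and a: "a = e \<oplus> d"
    using strongly_Delta_clean by blast
  have d: "d \<in> carrier R"
    using dD by (simp add: Delta_def)
  define v where "v = \<one> \<ominus> (e \<oplus> e)"
  have "v \<in> Units R"
    using e idempotent_involution[OF e] unfolding v_def Units_def by auto
  then have "d \<otimes> (v \<ominus> d) \<in> Delta R"
    using dD by (intro Delta_mult_Units Units_minus_Delta)
  \<comment> \<open>As \<open>e\<close> is idempotent and commutes with \<open>d\<close>,
    \<open>a a = e + 2de + dd\<close>; both sides equal \<open>d - 2de - dd\<close>.\<close>
  also have "d \<otimes> (v \<ominus> d) = a \<ominus> a \<otimes> a"
    using e d comm unfolding v_def a
    by (simp add: minus_eq minus_add l_distr r_distr l_minus r_minus a_ac r_neg r_neg1 r_neg2)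
  finally show "a \<ominus> a \<otimes> a \<in> Delta R" .
qed

end
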